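(* Let $A$ be a bialgebra over a field $k$ and let $M,N$ be left-right Yetter-Drinfel'd modules over $A$. Let $H^*(M,N)$ be the cohomology of the total complex of the double complex $(Y^{n,p}(M,N),d_m^{n,p},d_c^{n,p})_{n,p\ge 0}$ defined in the context. Then $H^0(M,N)$ is the set of morphisms from $M$ to $N$ in the category of left-right Yetter-Drinfel'd modules over $A$ (that is, of $k$-linear maps $M\to N$ that are both $A$-linear and $A$-colinear).
   Context: $k$ is a field, all linear spaces, tensor products and Homs are over $k$; $A^n$ denotes $A^{\otimes n}$ with $A^0=k$. Sweedler notation: $\Delta(a)=\sum a_1\otimes a_2$, iterated $\sum a_1\otimes\cdots\otimes a_{r}$. A left-right Yetter-Drinfel'd module over a bialgebra $A$ is a $k$-space $M$ that is a left $A$-module ($a\otimes m\mapsto a\cdot m$) and a right $A$-comodule ($\rho_M(m)=\sum m_0\otimes m_1\in M\otimes A$) with $$\sum (a_2\cdot m)_0\otimes (a_2\cdot m)_1a_1=\sum a_1\cdot m_0\otimes a_2m_1\quad\text{for all } a\in A,\ m\in M.$$ $Y^{n,p}(M,N)=\mathrm{Hom}(A^n\otimes M,N\otimes A^p)$ for $n,p\ge0$. For $f\in Y^{n,p}(M,N)$ write $f(x)=\sum f(x)^0\otimes f(x)^1\otimes\cdots\otimes f(x)^p$ with $f(x)^0\in N$ and $f(x)^j\in A$ for $j\ge1$. Superscripts on $a^1,\dots,a^n\in A$ are indices. Maps $b_i^{n,p}:Y^{n,p}\to Y^{n+1,p}$, $0\le i\le n+1$: - $b_0^{n,p}(f)(a^1\otimes\cdots\otimes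 a^{n+1}\otimes m)=\sum (a^1)_1\cdot f(x)^0\otimes (a^1)_2f(x)^1\otimes\cdots\otimes(a^1)_{p+1}f(x)^p$, with $x=a^2\otimes\cdots\otimes a^{n+1}\otimes m$; - $b_i^{n,p}(f)(a^1\otimes\cdots\otimes a^{n+1}\otimes m)=f(a^1\otimes\cdots\otimes a^ia^{i+1}\otimes\cdots\otimes a^{n+1}\otimes m)$ for $1\le i\le n$; - $b_{n+1}^{n,p}(f)(a^1\otimes\cdots\otimes a^{n+1}\otimes m)=\sum f(y)^0\otimes f(y)^1(a^{n+1})_1\otimes\cdots\otimes f(y)^p(a^{n+1})_p$, with $y=a^1\otimes\cdots\otimes a^n\otimes (a^{n+1})_{p+1}\cdot m$. Maps $c_i^{n,p}:Y^{n,p}\to Y^{n,p+1}$, $0\le i\le p+1$: - $c_0^{n,p}(f)(a^1\otimes\cdots\otimes a^n\otimes m)=\sum (f(z)^0)_0\otimes (f(z)^0)_1(a^1)_1\cdots(a^n)_1\otimes f(z)^1\otimes\cdots\otimes f(z)^p$, with $z=(a^1)_2\otimes\cdots\otimes(a^n)_2\otimes m$; - for $1\le i\le p$, $c_i^{n,p}(f)(x)=\sum f(x)^0\otimes\cdots\otimes (f(x)^i)_1\otimes(f(x)^i)_2\otimes\cdots\otimes f(x)^p$ ($\Delta$ applied to the $i$-th $A$-factor); - $c_{p+1}^{n,p}(f)(a^1\otimes\cdots\otimes a^n\otimes m)=\sum f((a^1)_1\otimes\cdots\otimes(a^n)_1\otimes m_0)\otimes (a^1)_2\cdots(a^n)_2m_1$.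 (Empty products, when $n=0$, equal $1$.) $d_m^{n,p}=\sum_{i=0}^{n+1}(-1)^ib_i^{n,p}$ and $d_c^{n,p}=\sum_{i=0}^{p+1}(-1)^ic_i^{n,p}$. These satisfy $d_md_m=0$, $d_cd_c=0$, $d_cd_m=d_md_c$. The total complex has degree-$r$ term $\bigoplus_{n+p=r}Y^{n,p}(M,N)$ and differential $d_m^{n,p}+(-1)^nd_c^{n,p}$ on $Y^{n,p}(M,N)$. *)

theory Defs
  imports Complex_Main "HOL-Library.Poly_Mapping" "HOL-Library.Function_Algebras"
begin

section \<open>Tensor products\<close>

text \<open>
  All tensor products that occur are of the form \<open>A^n \<otimes> V \<otimes> A^p\<close>, where \<open>A\<close> and \<open>V\<close> are vector
  spaces over the field \<open>'k\<close> with scalar multiplications \<open>sA\<close> and \<open>sV\<close>: the space \<open>A^n \<otimes> M\<close> is the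
  case \<open>p = 0\<close>, the space \<open>N \<otimes> A^p\<close> is the case \<open>n = 0\<close>, and \<open>A \<otimes> A^p\<close> is the case \<open>V = A\<close>,
  \<open>n = 0\<close>.  Formal linear combinations of the symbols \<open>(xs, v, ys)\<close> are finitely supported
  functions.
\<close>

type_synonym ('k, 'a, 'v) tens = "('a list \<times> 'v \<times> 'a list) \<Rightarrow>\<^sub>0 'k"

definition tscale :: "'k::field \<Rightarrow> ('x \<Rightarrow>\<^sub>0 'k) \<Rightarrow> ('x \<Rightarrow>\<^sub>0 'k)" where
  "tscale c u = Poly_Mapping.map (\<lambda>x. c * x) u"

definition gen :: "'a list \<Rightarrow> 'v \<Rightarrow> 'a list \<Rightarrow> ('k::field, 'a, 'v) tens" where
  "gen xs v ys = Poly_Mapping.single (xs, v, ys) 1"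

definition free_space :: "nat \<Rightarrow> nat \<Rightarrow> ('k::field, 'a, 'v) tens set" where
  "free_space n p =
     {u. \<forall>(xs, v, ys) \<in> Poly_Mapping.keys u. length xs = n \<and> length ys = p}"

definition tensor_relations ::
  "('k::field \<Rightarrow> 'a::ab_group_add \<Rightarrow> 'a) \<Rightarrow> ('k \<Rightarrow> 'v::ab_group_add \<Rightarrow> 'v) \<Rightarrow> nat \<Rightarrow> nat
     \<Rightarrow> ('k, 'a, 'v) tens set" where
  "tensor_relations sA sV n p = module.span tscale (
     {gen xs (v + w) ys - gen xs v ys - gen xs w ys | xs v w ys. length xs = n \<and> length ys = p}
   \<union> {gen xs (sV c v) ys - tscale c (gen xs v ys) | xs c v ys. length xs = n \<and> length ys = p}
   \<union> {gen (xs[i := a + b]) v ys - gen (xs[i := a]) v ys - gen (xs[i := b]) v ys | xs i a b v ys.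
        length xs = n \<and> length ys = p \<and> i < n}
   \<union> {gen (xs[i := sA c a]) v ys - tscale c (gen (xs[i := a]) v ys) | xs i c a v ys.
        length xs = n \<and> length ys = p \<and> i < n}
   \<union> {gen xs v (ys[i := a + b]) - gen xs v (ys[i := a]) - gen xs v (ys[i := b]) | xs v ys i a b.
        length xs = n \<and> length ys = p \<and> i < p}
   \<union> {gen xs v (ys[i := sA c a]) - tscale c (gen xs v (ys[i := a])) | xs v ys i c a.
        length xs = n \<and> length ys = p \<and> i < p})"

text \<open>
  The quotient of \<open>free_space n p\<close> by \<open>tensor_relations sA sV n p\<close> is represented by normal forms:
  \<open>nf\<close> is a fixed linear map that picks one element out of every coset of the relations
  (see \<open>nf_mod\<close>, \<open>nf_eq_iff\<close>), so that equality in the quotient becomes equality of normal forms.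
  The resulting space, with its pure tensors, has the universal property of the tensor
  product: see \<open>multilinear_pure\<close>, \<open>tensor_eq_span_pure\<close>, \<open>linear_lift\<close> and \<open>lift_pure\<close>.
\<close>

definition nf ::
  "('k::field \<Rightarrow> 'a::ab_group_add \<Rightarrow> 'a) \<Rightarrow> ('k \<Rightarrow> 'v::ab_group_add \<Rightarrow> 'v) \<Rightarrow> nat \<Rightarrow> nat
     \<Rightarrow> ('k, 'a, 'v) tens \<Rightarrow> ('k, 'a, 'v) tens" where
  "nf sA sV n p = (SOME h. Vector_Spaces.linear tscale tscale h \<and>
     (\<forall>u \<in> tensor_relations sA sV n p. h u = 0) \<and>
     (\<forall>u. u - h u \<in> tensor_relations sA sV n p))"

definition tensor ::
  "('k::field \<Rightarrow> 'a::ab_group_add \<Rightarrow> 'a) \<Rightarrow> ('k \<Rightarrow> 'v::ab_group_add \<Rightarrow> 'v) \<Rightarrow> nat \<Rightarrow> nat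
     \<Rightarrow> ('k, 'a, 'v) tens set" where
  "tensor sA sV n p = nf sA sV n p ` free_space n p"

definition pure ::
  "('k::field \<Rightarrow> 'a::ab_group_add \<Rightarrow> 'a) \<Rightarrow> ('k \<Rightarrow> 'v::ab_group_add \<Rightarrow> 'v)
     \<Rightarrow> 'a list \<Rightarrow> 'v \<Rightarrow> 'a list \<Rightarrow> ('k, 'a, 'v) tens" where
  "pure sA sV xs v ys = nf sA sV (length xs) (length ys) (gen xs v ys)"

text \<open>
  The linear extension of \<open>g\<close> to tensors; for multilinear \<open>g\<close> it is the map induced by \<open>g\<close>.
  Reading \<open>t\<close> as a sum of pure tensors, \<open>lift s g t\<close> is what Sweedler notation abbreviates.
\<close>

definition lift ::
  "('k::field \<Rightarrow> 'w::ab_group_add \<Rightarrow> 'w) \<Rightarrow> ('a list \<Rightarrow> 'v \<Rightarrow> 'a list \<Rightarrow> 'w) \<Rightarrow> ('k, 'a, 'v) tens \<Rightarrow> 'w"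
  where
  "lift s g t = (\<Sum>x \<in> Poly_Mapping.keys t.
     s (Poly_Mapping.lookup t x) (case x of (xs, v, ys) \<Rightarrow> g xs v ys))"

definition multilinear ::
  "('k::field \<Rightarrow> 'a::ab_group_add \<Rightarrow> 'a) \<Rightarrow> ('k \<Rightarrow> 'v::ab_group_add \<Rightarrow> 'v)
     \<Rightarrow> ('k \<Rightarrow> 'w::ab_group_add \<Rightarrow> 'w) \<Rightarrow> nat \<Rightarrow> nat \<Rightarrow> ('a list \<Rightarrow> 'v \<Rightarrow> 'a list \<Rightarrow> 'w) \<Rightarrow> bool" where
  "multilinear sA sV s n p g \<longleftrightarrow> (\<forall>xs v ys. length xs = n \<longrightarrow> length ys = p \<longrightarrow>
     Vector_Spaces.linear sV s (\<lambda>v. g xs v ys) \<and>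
     (\<forall>i<n. Vector_Spaces.linear sA s (\<lambda>a. g (xs[i := a]) v ys)) \<and>
     (\<forall>i<p. Vector_Spaces.linear sA s (\<lambda>a. g xs v (ys[i := a]))))"

lemma lookup_tscale [simp]: "Poly_Mapping.lookup (tscale c u) x = c * Poly_Mapping.lookup u x"
  unfolding tscale_def by (simp add: Poly_Mapping.map.rep_eq when_def)

lemma vector_space_tscale: "vector_space (tscale :: 'k::field \<Rightarrow> ('x \<Rightarrow>\<^sub>0 'k) \<Rightarrow> _)"
  by unfold_locales
    (auto intro!: poly_mapping_eqI simp: Poly_Mapping.lookup_add algebra_simps)

lemma nf_exists:
  fixes sA :: "'k::field \<Rightarrow> 'a::ab_group_add \<Rightarrow> 'a" and sV :: "'k \<Rightarrow> 'v::ab_group_add \<Rightarrow> 'v"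
  shows "\<exists>h. Vector_Spaces.linear tscale tscale h \<and> (\<forall>u \<in> tensor_relations sA sV n p. h u = 0) \<and>
     (\<forall>u. u - h u \<in> tensor_relations sA sV n p)"
proof -
  interpret V: vector_space "tscale :: 'k \<Rightarrow> ('k, 'a, 'v) tens \<Rightarrow> _"
    by (rule vector_space_tscale)
  interpret VP: vector_space_pair
    "tscale :: 'k \<Rightarrow> ('k, 'a, 'v) tens \<Rightarrow> _"
    "tscale :: 'k \<Rightarrow> ('k, 'a, 'v) tens \<Rightarrow> _"
    by unfold_locales
  have sub: "V.subspace (tensor_relations sA sV n p)"
    unfolding tensor_relations_def by (rule V.subspace_span)
  obtain g where g: "range g \<subseteq> tensor_relations sA sV n p" "Vector_Spaces.linear tscale tscale g"
    "\<forall>u \<in> tensor_relations sA sV n p. g u = u"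
    using VP.linear_exists_left_inverse_on[OF V.linear_ident sub] by auto
  have "Vector_Spaces.linear tscale tscale (\<lambda>u. u - g u)"
    by (intro VP.linear_compose_sub V.linear_ident g(2))
  with g show ?thesis by (intro exI[of _ "\<lambda>u. u - g u"]) auto
qed

lemma
  shows linear_nf: "Vector_Spaces.linear tscale tscale (nf sA sV n p)"
    and nf_relation: "u \<in> tensor_relations sA sV n p \<Longrightarrow> nf sA sV n p u = 0"
    and nf_mod: "u - nf sA sV n p u \<in> tensor_relations sA sV n p"
  using someI_ex[OF nf_exists[of sA sV n p]] unfolding nf_def by blast+

lemma nf_eq_iff: "nf sA sV n p u = nf sA sV n p w \<longleftrightarrow> u - w \<in> tensor_relations sA sV n p"
proof -
  interpret L: Vector_Spaces.linear tscale tscale "nf sA sV n p" by (rule linear_nf)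
  have sub: "L.vs1.subspace (tensor_relations sA sV n p)"
    unfolding tensor_relations_def by (rule L.vs1.subspace_span)
  show ?thesis
  proof
    assume eq: "nf sA sV n p u = nf sA sV n p w"
    have "(u - nf sA sV n p u) - (w - nf sA sV n p w) \<in> tensor_relations sA sV n p"
      by (intro L.vs1.subspace_diff[OF sub] nf_mod)
    with eq show "u - w \<in> tensor_relations sA sV n p" by simp
  next
    assume "u - w \<in> tensor_relations sA sV n p"
    then have "nf sA sV n p (u - w) = 0" by (rule nf_relation)
    then show "nf sA sV n p u = nf sA sV n p w" by (simp add: L.diff)
  qed
qed

lemma lift_superset:
  assumes "vector_space s" "finite X" "Poly_Mapping.keys t \<subseteq> X"
  shows "lift s g t = (\<Sum>x \<in> X. s (Poly_Mapping.lookup t x) (case x of (xs, v, ys) \<Rightarrow> g xs v ys))"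
proof -
  interpret vector_space s by fact
  show ?thesis unfolding lift_def
    by (rule sum.mono_neutral_left) (use assms in \<open>auto simp: in_keys_iff\<close>)
qed

lemma linear_lift:
  assumes "vector_space s"
  shows "Vector_Spaces.linear tscale s (lift s g)"
proof -
  interpret vector_space s by fact
  have add: "lift s g (t + u) = lift s g t + lift s g u" for t u
  proof -
    let ?X = "Poly_Mapping.keys t \<union> Poly_Mapping.keys u"
    have fin: "finite ?X" by simp
    have "Poly_Mapping.keys (t + u) \<subseteq> ?X" by (rule Poly_Mapping.keys_add)
    then show ?thesis
      by (simp add: lift_superset[OF assms fin] Poly_Mapping.lookup_add scale_left_distrib
          sum.distrib)
  qed
  have sc: "lift s g (tscale c t) = s c (lift s g t)" for c t
  proof -
    have "Poly_Mapping.keys (tscale c t) \<subseteq> Poly_Mapping.keys t"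
      by (auto simp: in_keys_iff)
    then show ?thesis
      by (simp add: lift_superset[OF assms finite_keys, of _ t] scale_sum_right)
  qed
  show ?thesis
    unfolding Vector_Spaces.linear_iff using assms vector_space_tscale add sc by blast
qed

lemma lift_gen: "vector_space s \<Longrightarrow> lift s g (gen xs v ys) = g xs v ys"
proof -
  assume "vector_space s"
  then interpret vector_space s .
  show ?thesis by (simp add: lift_def gen_def)
qed

lemma lift_relation:
  assumes s: "vector_space s" and g: "multilinear sA sV s n p g"
    and u: "u \<in> tensor_relations sA sV n p"
  shows "lift s g u = 0"
proof -
  interpret L: Vector_Spaces.linear tscale s "lift s g" by (rule linear_lift[OF s])
  have k: "L.vs1.subspace {u. lift s g u = 0}" by (rule L.subspace_kernel)
  note lin = g[unfolded multilinear_def Vector_Spaces.linear_iff]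
  show ?thesis
    using u unfolding tensor_relations_def
  proof (rule L.vs1.span_induct[OF _ k])
  qed (use lin in \<open>auto simp: L.diff L.scale lift_gen[OF s]\<close>)
qed

lemma lift_nf:
  assumes "vector_space s" "multilinear sA sV s n p g"
  shows "lift s g (nf sA sV n p u) = lift s g u"
proof -
  interpret L: Vector_Spaces.linear tscale s "lift s g" by (rule linear_lift) fact
  show ?thesis using lift_relation[OF assms nf_mod[of u sA sV n p]] by (simp add: L.diff)
qed

lemma lift_pure:
  assumes "vector_space s" "multilinear sA sV s n p g" "length xs = n" "length ys = p"
  shows "lift s g (pure sA sV xs v ys) = g xs v ys"
  using assms by (simp add: pure_def lift_nf lift_gen)

lemma multilinear_pure:
  assumes sA: "vector_space sA" and sV: "vector_space sV"
  shows "multilinear sA sV tscale n p (pure sA sV)"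
proof -
  interpret L: Vector_Spaces.linear tscale tscale "nf sA sV n p" by (rule linear_nf)
  note R = nf_relation[unfolded tensor_relations_def, OF L.vs1.span_base]
  have add: "nf sA sV n p u = nf sA sV n p w + nf sA sV n p z"
    if "nf sA sV n p (u - w - z) = 0" for u w z
    using that by (simp add: L.diff diff_diff_eq L.add)
  have sc: "nf sA sV n p u = tscale c (nf sA sV n p w)"
    if "nf sA sV n p (u - tscale c w) = 0" for u w c
    using that by (simp only: L.diff L.scale right_minus_eq)
  have R1: "nf sA sV n p (gen xs (v + w) ys - gen xs v ys - gen xs w ys) = 0"
    if "length xs = n" "length ys = p" for xs v w ys
    by (rule R, rule UnI1, rule UnI1, rule UnI1, rule UnI1, rule UnI1,
        intro CollectI exI conjI, rule refl, (fact that)+)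
  have R2: "nf sA sV n p (gen xs (sV c v) ys - tscale c (gen xs v ys)) = 0"
    if "length xs = n" "length ys = p" for xs c v ys
    by (rule R, rule UnI1, rule UnI1, rule UnI1, rule UnI1, rule UnI2,
        intro CollectI exI conjI, rule refl, (fact that)+)
  have R3: "nf sA sV n p (gen (xs[i := a + b]) v ys - gen (xs[i := a]) v ys - gen (xs[i := b]) v ys) = 0"
    if "length xs = n" "length ys = p" "i < n" for xs i a b v ys
    by (rule R, rule UnI1, rule UnI1, rule UnI1, rule UnI2,
        intro CollectI exI conjI, rule refl, (fact that)+)
  have R4: "nf sA sV n p (gen (xs[i := sA c a]) v ys - tscale c (gen (xs[i := a]) v ys)) = 0"
    if "length xs = n" "length ys = p" "i < n" for xs i c a v ys
    by (rule R, rule UnI1, rule UnI1, rule UnI2,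
        intro CollectI exI conjI, rule refl, (fact that)+)
  have R5: "nf sA sV n p (gen xs v (ys[i := a + b]) - gen xs v (ys[i := a]) - gen xs v (ys[i := b])) = 0"
    if "length xs = n" "length ys = p" "i < p" for xs v ys i a b
    by (rule R, rule UnI1, rule UnI2,
        intro CollectI exI conjI, rule refl, (fact that)+)
  have R6: "nf sA sV n p (gen xs v (ys[i := sA c a]) - tscale c (gen xs v (ys[i := a]))) = 0"
    if "length xs = n" "length ys = p" "i < p" for xs v ys i c a
    by (rule R, rule UnI2,
        intro CollectI exI conjI, rule refl, (fact that)+)
  show ?thesis
    unfolding multilinear_def Vector_Spaces.linear_iff
    by (intro allI impI conjI sA sV vector_space_tscale)
      (simp_all add: pure_def add[OF R1] sc[OF R2] add[OF R3] sc[OF R4] add[OF R5] sc[OF R6])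
qed

lemma tensor_eq_span_pure:
  fixes sA :: "'k::field \<Rightarrow> 'a::ab_group_add \<Rightarrow> 'a" and sV :: "'k \<Rightarrow> 'v::ab_group_add \<Rightarrow> 'v"
  shows "tensor sA sV n p =
     module.span tscale {pure sA sV xs v ys | xs v ys. length xs = n \<and> length ys = p}"
    (is "_ = module.span tscale ?P")
proof -
  interpret L: Vector_Spaces.linear tscale tscale "nf sA sV n p" by (rule linear_nf)
  have free_mono: "w \<in> free_space n p"
    if "\<forall>x \<in> Poly_Mapping.keys w. x \<in> Poly_Mapping.keys u \<or> x \<in> Poly_Mapping.keys u'"
      "u \<in> free_space n p" "u' \<in> free_space n p" for u u' w :: "('k, 'a, 'v) tens"
    unfolding free_space_def mem_Collect_eq
  proof
    fix x assume "x \<in> Poly_Mapping.keys w"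
    with that(1) have "x \<in> Poly_Mapping.keys u \<or> x \<in> Poly_Mapping.keys u'" by simp
    then show "case x of (xs, v, ys) \<Rightarrow> length xs = n \<and> length ys = p"
      using that(2,3) unfolding free_space_def mem_Collect_eq by (elim disjE) (erule (1) bspec)+
  qed
  have sub: "L.vs1.subspace (free_space n p)"
  proof (rule L.vs1.subspaceI)
    show "(0 :: ('k, 'a, 'v) tens) \<in> free_space n p" by (simp add: free_space_def)
    show "u + w \<in> free_space n p" if "u \<in> free_space n p" "w \<in> free_space n p"
      for u w :: "('k, 'a, 'v) tens"
      using subsetD[OF Poly_Mapping.keys_add[of u w]] by (intro free_mono[OF _ that]) simp
    show "tscale c u \<in> free_space n p" if "u \<in> free_space n p"
      for c and u :: "('k, 'a, 'v) tens"
      by (rule free_mono[OF _ that that]) (simp add: in_keys_iff)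
  qed
  have "nf sA sV n p u \<in> L.vs1.span ?P" if u: "u \<in> free_space n p"
    for u :: "('k, 'a, 'v) tens"
  proof -
    have "u = (\<Sum>x \<in> Poly_Mapping.keys u. tscale (Poly_Mapping.lookup u x)
        (case x of (xs, v, ys) \<Rightarrow> gen xs v ys))"
    proof (rule poly_mapping_eqI)
      fix y
      have "(\<Sum>x \<in> Poly_Mapping.keys u. Poly_Mapping.lookup (tscale (Poly_Mapping.lookup u x)
          (case x of (xs, v, ys) \<Rightarrow> gen xs v ys)) y) =
        (\<Sum>x \<in> Poly_Mapping.keys u. if x = y then Poly_Mapping.lookup u x else 0)"
        by (rule sum.cong) (auto simp: gen_def Poly_Mapping.lookup_single when_def)
      then show "Poly_Mapping.lookup u y = Poly_Mapping.lookup
          (\<Sum>x \<in> Poly_Mapping.keys u. tscale (Poly_Mapping.lookup u x)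
            (case x of (xs, v, ys) \<Rightarrow> gen xs v ys)) y"
        by (simp add: Poly_Mapping.lookup_sum in_keys_iff)
    qed
    then have "nf sA sV n p u = nf sA sV n p (\<Sum>x \<in> Poly_Mapping.keys u.
        tscale (Poly_Mapping.lookup u x) (case x of (xs, v, ys) \<Rightarrow> gen xs v ys))"
      by (rule arg_cong)
    also have "\<dots> = (\<Sum>x \<in> Poly_Mapping.keys u. tscale (Poly_Mapping.lookup u x)
        (nf sA sV n p (case x of (xs, v, ys) \<Rightarrow> gen xs v ys)))"
      by (simp only: L.scale L.sum)
    also have "\<dots> \<in> L.vs1.span ?P"
    proof (intro L.vs1.span_sum L.vs1.span_scale L.vs1.span_base)
      fix x assume "x \<in> Poly_Mapping.keys u"
      moreover obtain xs v ys where "x = (xs, v, ys)" by (cases x) auto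
      ultimately have "nf sA sV n p (case x of (xs, v, ys) \<Rightarrow> gen xs v ys) = pure sA sV xs v ys"
        "length xs = n" "length ys = p"
        using u by (auto simp: free_space_def pure_def)
      then show "nf sA sV n p (case x of (xs, v, ys) \<Rightarrow> gen xs v ys) \<in> ?P" by blast
    qed
    finally show ?thesis .
  qed
  moreover have "L.vs1.span ?P \<subseteq> tensor sA sV n p"
  proof (rule L.vs1.span_minimal)
    show "?P \<subseteq> tensor sA sV n p"
      unfolding tensor_def pure_def by (auto intro!: imageI simp: free_space_def gen_def)
    show "L.vs1.subspace (tensor sA sV n p)"
      unfolding tensor_def by (rule L.subspace_image[OF sub])
  qed
  ultimately show ?thesis unfolding tensor_def by blast
qed


section \<open>Bialgebras and Yetter-Drinfel'd modules\<close>

text \<open>The sum of \<open>g t\<^sub>0 t\<^sub>1\<close> for an element \<open>t = \<Sum> t\<^sub>0 \<otimes> t\<^sub>1\<close> of \<open>V \<otimes> A\<close>.\<close>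

definition sw ::
  "('k::field \<Rightarrow> 'w::ab_group_add \<Rightarrow> 'w) \<Rightarrow> ('v \<Rightarrow> 'a \<Rightarrow> 'w) \<Rightarrow> ('k, 'a, 'v) tens \<Rightarrow> 'w" where
  "sw s g t = lift s (\<lambda>_ v ys. g v (hd ys)) t"

record (overloaded) ('k, 'a) bialg =
  ascale :: "'k \<Rightarrow> 'a \<Rightarrow> 'a"
  comul :: "'a \<Rightarrow> ('k, 'a, 'a) tens"
  counit :: "'a \<Rightarrow> 'k"

locale bialgebra =
  fixes A :: "('k::field, 'a::ring_1) bialg"
  assumes vector_space_A: "vector_space (ascale A)"
    and scale_mult_left: "ascale A c a * b = ascale A c (a * b)"
    and scale_mult_right: "a * ascale A c b = ascale A c (a * b)"
    and comul_in: "comul A a \<in> tensor (ascale A) (ascale A) 0 1"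
    and comul_linear: "Vector_Spaces.linear (ascale A) tscale (comul A)"
    and counit_linear: "Vector_Spaces.linear (ascale A) (*) (counit A)"
    and coassoc:
      "sw tscale (\<lambda>a1 a2. sw tscale (\<lambda>b1 b2. pure (ascale A) (ascale A) [] b1 [b2, a2])
         (comul A a1)) (comul A a) =
       sw tscale (\<lambda>a1 a2. sw tscale (\<lambda>b1 b2. pure (ascale A) (ascale A) [] a1 [b1, b2])
         (comul A a2)) (comul A a)"
    and counit_left: "sw (ascale A) (\<lambda>a1 a2. ascale A (counit A a1) a2) (comul A a) = a"
    and counit_right: "sw (ascale A) (\<lambda>a1 a2. ascale A (counit A a2) a1) (comul A a) = a"
    and comul_mult:
      "comul A (a * b) =
       sw tscale (\<lambda>a1 a2. sw tscale (\<lambda>b1 b2. pure (ascale A) (ascale A) [] (a1 * b1) [a2 * b2])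
         (comul A b)) (comul A a)"
    and comul_one: "comul A 1 = pure (ascale A) (ascale A) [] 1 [1]"
    and counit_mult: "counit A (a * b) = counit A a * counit A b"
    and counit_one: "counit A 1 = 1"

record (overloaded) ('k, 'a, 'm) yd =
  mscale :: "'k \<Rightarrow> 'm \<Rightarrow> 'm"
  act :: "'a \<Rightarrow> 'm \<Rightarrow> 'm"
  coact :: "'m \<Rightarrow> ('k, 'a, 'm) tens"

locale yetter_drinfeld = bialgebra A
  for A :: "('k::field, 'a::ring_1) bialg" +
  fixes M :: "('k, 'a, 'm::ab_group_add) yd"
  assumes vector_space_M: "vector_space (mscale M)"
    and act_linear_left: "Vector_Spaces.linear (ascale A) (mscale M) (\<lambda>a. act M a m)"
    and act_linear_right: "Vector_Spaces.linear (mscale M) (mscale M) (act M a)"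
    and act_one: "act M 1 m = m"
    and act_mult: "act M (a * b) m = act M a (act M b m)"
    and coact_in: "coact M m \<in> tensor (ascale A) (mscale M) 0 1"
    and coact_linear: "Vector_Spaces.linear (mscale M) tscale (coact M)"
    and coact_coassoc:
      "sw tscale (\<lambda>m0 m1. sw tscale (\<lambda>n0 n1. pure (ascale A) (mscale M) [] n0 [n1, m1])
         (coact M m0)) (coact M m) =
       sw tscale (\<lambda>m0 m1. sw tscale (\<lambda>a1 a2. pure (ascale A) (mscale M) [] m0 [a1, a2])
         (comul A m1)) (coact M m)"
    and coact_counit: "sw (mscale M) (\<lambda>m0 m1. mscale M (counit A m1) m0) (coact M m) = m"
    and compatibility:
      "sw tscale (\<lambda>a1 a2. sw tscale (\<lambda>n0 n1. pure (ascale A) (mscale M) [] n0 [n1 * a1])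
         (coact M (act M a2 m))) (comul A a) =
       sw tscale (\<lambda>a1 a2. sw tscale (\<lambda>m0 m1.
         pure (ascale A) (mscale M) [] (act M a1 m0) [a2 * m1]) (coact M m)) (comul A a)"

definition yd_homs ::
  "('k::field, 'a::ring_1) bialg \<Rightarrow> ('k, 'a, 'm::ab_group_add) yd \<Rightarrow> ('k, 'a, 'n::ab_group_add) yd
     \<Rightarrow> ('m \<Rightarrow> 'n) set" where
  "yd_homs A M N = {f. Vector_Spaces.linear (mscale M) (mscale N) f \<and>
     (\<forall>a m. f (act M a m) = act N a (f m)) \<and>
     (\<forall>m. coact N (f m) =
        sw tscale (\<lambda>m0 m1. pure (ascale A) (mscale N) [] (f m0) [m1]) (coact M m))}"


section \<open>The double complex\<close>

text \<open>
  Linear maps between subspaces \<open>X\<close> and \<open>Y\<close>, extended by zero outside of \<open>X\<close>, so that two of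
  them are equal iff they agree on \<open>X\<close>.
\<close>

definition hom_space ::
  "('k \<Rightarrow> 'x::ab_group_add \<Rightarrow> 'x) \<Rightarrow> ('k \<Rightarrow> 'y::ab_group_add \<Rightarrow> 'y) \<Rightarrow> 'x set \<Rightarrow> 'y set
     \<Rightarrow> ('x \<Rightarrow> 'y) set" where
  "hom_space s t X Y = {f. (\<forall>x\<in>X. f x \<in> Y) \<and> (\<forall>x\<in>X. \<forall>x'\<in>X. f (x + x') = f x + f x') \<and>
     (\<forall>c. \<forall>x\<in>X. f (s c x) = t c (f x)) \<and> (\<forall>x. x \<notin> X \<longrightarrow> f x = 0)}"

definition Y_space ::
  "('k::field, 'a::ring_1) bialg \<Rightarrow> ('k, 'a, 'm::ab_group_add) yd \<Rightarrow> ('k, 'a, 'n::ab_group_add) yd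
     \<Rightarrow> nat \<Rightarrow> nat \<Rightarrow> (('k, 'a, 'm) tens \<Rightarrow> ('k, 'a, 'n) tens) set" where
  "Y_space A M N n p = hom_space tscale tscale
     (tensor (ascale A) (mscale M) n 0) (tensor (ascale A) (mscale N) 0 p)"

text \<open>The linear map on \<open>A^n \<otimes> M\<close> given on pure tensors by a multilinear \<open>g\<close>.\<close>

definition hom_of ::
  "('k::field, 'a::ring_1) bialg \<Rightarrow> ('k, 'a, 'm::ab_group_add) yd \<Rightarrow> nat
     \<Rightarrow> ('a list \<Rightarrow> 'm \<Rightarrow> ('k, 'a, 'n::ab_group_add) tens)
     \<Rightarrow> ('k, 'a, 'm) tens \<Rightarrow> ('k, 'a, 'n) tens" where
  "hom_of A M n g t =
     (if t \<in> tensor (ascale A) (mscale M) n 0 then lift tscale (\<lambda>as m _. g as m) t else 0)"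

text \<open>The iterated comultiplication \<open>a \<mapsto> \<Sum> a\<^sub>1 \<otimes> \<dots> \<otimes> a\<^bsub>r + 1\<^esub>\<close>, as an element of \<open>A \<otimes> A^r\<close>.\<close>

primrec iter_comul :: "('k::field, 'a::ring_1) bialg \<Rightarrow> nat \<Rightarrow> 'a \<Rightarrow> ('k, 'a, 'a) tens" where
  "iter_comul A 0 a = pure (ascale A) (ascale A) [] a []"
| "iter_comul A (Suc r) a = lift tscale (\<lambda>_ b bs. sw tscale
     (\<lambda>b1 b2. pure (ascale A) (ascale A) [] b1 (b2 # bs)) (comul A b)) (iter_comul A r a)"

text \<open>The sum of \<open>g [a\<^sub>1, \<dots>, a\<^bsub>r + 1\<^esub>]\<close> in Sweedler notation.\<close>

definition sw_iter ::
  "('k::field, 'a::ring_1) bialg \<Rightarrow> nat \<Rightarrow> ('a list \<Rightarrow> ('k, 'x, 'y) tens) \<Rightarrow> 'a \<Rightarrow> ('k, 'x, 'y) tens"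
  where
  "sw_iter A r g a = lift tscale (\<lambda>_ b bs. g (b # bs)) (iter_comul A r a)"

text \<open>
  The sum of \<open>g [a\<^sup>1\<^sub>1, \<dots>, a\<^sup>n\<^sub>1] [a\<^sup>1\<^sub>2, \<dots>, a\<^sup>n\<^sub>2]\<close> for a list \<open>[a\<^sup>1, \<dots>, a\<^sup>n]\<close> of elements of \<open>A\<close>,
  each of which is comultiplied once.
\<close>

primrec sw_list ::
  "('k::field, 'a::ring_1) bialg \<Rightarrow> ('a list \<Rightarrow> 'a list \<Rightarrow> ('k, 'x, 'y) tens) \<Rightarrow> 'a list
     \<Rightarrow> ('k, 'x, 'y) tens" where
  "sw_list A g [] = g [] []"
| "sw_list A g (a # as) = sw tscale
     (\<lambda>a1 a2. sw_list A (\<lambda>us vs. g (a1 # us) (a2 # vs)) as) (comul A a)"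

text \<open>The maps \<open>b\<^sub>i\<close>; list positions count from \<open>0\<close>, so that \<open>a\<^sup>i\<close> is \<open>as ! (i - 1)\<close>.\<close>

definition b_map ::
  "('k::field, 'a::ring_1) bialg \<Rightarrow> ('k, 'a, 'm::ab_group_add) yd \<Rightarrow> ('k, 'a, 'n::ab_group_add) yd
     \<Rightarrow> nat \<Rightarrow> nat \<Rightarrow> nat \<Rightarrow> (('k, 'a, 'm) tens \<Rightarrow> ('k, 'a, 'n) tens)
     \<Rightarrow> ('k, 'a, 'm) tens \<Rightarrow> ('k, 'a, 'n) tens" where
  "b_map A M N n p i f = hom_of A M (n + 1) (\<lambda>as m.
     if i = 0 then
       sw_iter A p (\<lambda>us. lift tscale
           (\<lambda>_ v ys. pure (ascale A) (mscale N) [] (act N (hd us) v) (map2 (*) (tl us) ys))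
           (f (pure (ascale A) (mscale M) (tl as) m [])))
         (hd as)
     else if i \<le> n then
       f (pure (ascale A) (mscale M)
            (take (i - 1) as @ [as ! (i - 1) * as ! i] @ drop (i + 1) as) m [])
     else
       sw_iter A p (\<lambda>us. lift tscale
           (\<lambda>_ v ys. pure (ascale A) (mscale N) [] v (map2 (*) ys (butlast us)))
           (f (pure (ascale A) (mscale M) (butlast as) (act M (last us) m) [])))
         (last as))"

definition c_map ::
  "('k::field, 'a::ring_1) bialg \<Rightarrow> ('k, 'a, 'm::ab_group_add) yd \<Rightarrow> ('k, 'a, 'n::ab_group_add) yd
     \<Rightarrow> nat \<Rightarrow> nat \<Rightarrow> nat \<Rightarrow> (('k, 'a, 'm) tens \<Rightarrow> ('k, 'a, 'n) tens)
     \<Rightarrow> ('k, 'a, 'm) tens \<Rightarrow> ('k, 'a, 'n) tens" where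
  "c_map A M N n p i f = hom_of A M n (\<lambda>as m.
     if i = 0 then
       sw_list A (\<lambda>us vs. lift tscale
           (\<lambda>_ v ys. sw tscale
              (\<lambda>v0 v1. pure (ascale A) (mscale N) [] v0 ((v1 * prod_list us) # ys)) (coact N v))
           (f (pure (ascale A) (mscale M) vs m [])))
         as
     else if i \<le> p then
       lift tscale
         (\<lambda>_ v ys. sw tscale
            (\<lambda>y1 y2. pure (ascale A) (mscale N) [] v (take (i - 1) ys @ [y1, y2] @ drop i ys))
            (comul A (ys ! (i - 1))))
         (f (pure (ascale A) (mscale M) as m []))
     else
       sw_list A (\<lambda>us vs. sw tscale
           (\<lambda>m0 m1. lift tscale
              (\<lambda>_ v ys. pure (ascale A) (mscale N) [] v (ys @ [prod_list vs * m1]))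
              (f (pure (ascale A) (mscale M) us m0 [])))
           (coact M m))
         as)"

definition d_m ::
  "('k::field, 'a::ring_1) bialg \<Rightarrow> ('k, 'a, 'm::ab_group_add) yd \<Rightarrow> ('k, 'a, 'n::ab_group_add) yd
     \<Rightarrow> nat \<Rightarrow> nat \<Rightarrow> (('k, 'a, 'm) tens \<Rightarrow> ('k, 'a, 'n) tens)
     \<Rightarrow> ('k, 'a, 'm) tens \<Rightarrow> ('k, 'a, 'n) tens" where
  "d_m A M N n p f = (\<lambda>t. \<Sum>i\<le>n + 1. tscale ((-1) ^ i) (b_map A M N n p i f t))"

definition d_c ::
  "('k::field, 'a::ring_1) bialg \<Rightarrow> ('k, 'a, 'm::ab_group_add) yd \<Rightarrow> ('k, 'a, 'n::ab_group_add) yd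
     \<Rightarrow> nat \<Rightarrow> nat \<Rightarrow> (('k, 'a, 'm) tens \<Rightarrow> ('k, 'a, 'n) tens)
     \<Rightarrow> ('k, 'a, 'm) tens \<Rightarrow> ('k, 'a, 'n) tens" where
  "d_c A M N n p f = (\<lambda>t. \<Sum>i\<le>p + 1. tscale ((-1) ^ i) (c_map A M N n p i f t))"


section \<open>The total complex and its cohomology\<close>

text \<open>A cochain \<open>\<phi>\<close> has the component \<open>\<phi> n p\<close> in \<open>Y\<^sup>n\<^sup>,\<^sup>p\<close>.\<close>

type_synonym ('k, 'a, 'm, 'n) cochain = "nat \<Rightarrow> nat \<Rightarrow> ('k, 'a, 'm) tens \<Rightarrow> ('k, 'a, 'n) tens"

definition cochain_scale ::
  "'k::field \<Rightarrow> ('k, 'a, 'm, 'n) cochain \<Rightarrow> ('k, 'a, 'm, 'n) cochain" where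
  "cochain_scale c \<phi> = (\<lambda>n p t. tscale c (\<phi> n p t))"

definition total_cochains ::
  "('k::field, 'a::ring_1) bialg \<Rightarrow> ('k, 'a, 'm::ab_group_add) yd \<Rightarrow> ('k, 'a, 'n::ab_group_add) yd
     \<Rightarrow> nat \<Rightarrow> ('k, 'a, 'm, 'n) cochain set" where
  "total_cochains A M N r = {\<phi>. \<forall>n p. if n + p = r then \<phi> n p \<in> Y_space A M N n p else \<phi> n p = 0}"

definition total_d ::
  "('k::field, 'a::ring_1) bialg \<Rightarrow> ('k, 'a, 'm::ab_group_add) yd \<Rightarrow> ('k, 'a, 'n::ab_group_add) yd
     \<Rightarrow> ('k, 'a, 'm, 'n) cochain \<Rightarrow> ('k, 'a, 'm, 'n) cochain" where
  "total_d A M N \<phi> = (\<lambda>n p t.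
     (if n = 0 then 0 else d_m A M N (n - 1) p (\<phi> (n - 1) p) t) +
     (if p = 0 then 0 else tscale ((-1) ^ n) (d_c A M N n (p - 1) (\<phi> n (p - 1)) t)))"

definition cocycles ::
  "('k::field, 'a::ring_1) bialg \<Rightarrow> ('k, 'a, 'm::ab_group_add) yd \<Rightarrow> ('k, 'a, 'n::ab_group_add) yd
     \<Rightarrow> nat \<Rightarrow> ('k, 'a, 'm, 'n) cochain set" where
  "cocycles A M N r = {\<phi> \<in> total_cochains A M N r. total_d A M N \<phi> = 0}"

definition coboundaries ::
  "('k::field, 'a::ring_1) bialg \<Rightarrow> ('k, 'a, 'm::ab_group_add) yd \<Rightarrow> ('k, 'a, 'n::ab_group_add) yd
     \<Rightarrow> nat \<Rightarrow> ('k, 'a, 'm, 'n) cochain set" where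
  "coboundaries A M N r = (if r = 0 then {0} else total_d A M N ` total_cochains A M N (r - 1))"

definition coh_class ::
  "('k::field, 'a::ring_1) bialg \<Rightarrow> ('k, 'a, 'm::ab_group_add) yd \<Rightarrow> ('k, 'a, 'n::ab_group_add) yd
     \<Rightarrow> nat \<Rightarrow> ('k, 'a, 'm, 'n) cochain \<Rightarrow> ('k, 'a, 'm, 'n) cochain set" where
  "coh_class A M N r \<phi> = {\<phi> + \<beta> | \<beta>. \<beta> \<in> coboundaries A M N r}"

definition cohomology ::
  "('k::field, 'a::ring_1) bialg \<Rightarrow> ('k, 'a, 'm::ab_group_add) yd \<Rightarrow> ('k, 'a, 'n::ab_group_add) yd
     \<Rightarrow> nat \<Rightarrow> ('k, 'a, 'm, 'n) cochain set set" where
  "cohomology A M N r = coh_class A M N r ` cocycles A M N r"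

text \<open>
  The vector space operations of the quotient space \<open>cohomology A M N r\<close>.  The coboundary is
  added in \<open>coh_scale\<close> because scaling a coset elementwise by \<open>c = 0\<close> does not give a coset.
\<close>

definition coh_add ::
  "('k::field, 'a, 'm, 'n) cochain set \<Rightarrow> ('k, 'a, 'm, 'n) cochain set
     \<Rightarrow> ('k, 'a, 'm, 'n) cochain set" where
  "coh_add X Z = {\<phi> + \<psi> | \<phi> \<psi>. \<phi> \<in> X \<and> \<psi> \<in> Z}"

definition coh_scale ::
  "('k::field, 'a::ring_1) bialg \<Rightarrow> ('k, 'a, 'm::ab_group_add) yd \<Rightarrow> ('k, 'a, 'n::ab_group_add) yd
     \<Rightarrow> nat \<Rightarrow> 'k \<Rightarrow> ('k, 'a, 'm, 'n) cochain set \<Rightarrow> ('k, 'a, 'm, 'n) cochain set" where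
  "coh_scale A M N r c X =
     {cochain_scale c \<phi> + \<beta> | \<phi> \<beta>. \<phi> \<in> X \<and> \<beta> \<in> coboundaries A M N r}"

text \<open>
  A linear map \<open>M \<rightarrow> N\<close> as an element of \<open>Y\<^sup>0\<^sup>,\<^sup>0 = Hom(A^0 \<otimes> M, N \<otimes> A^0)\<close>, through the canonical
  identifications of \<open>A^0 \<otimes> M\<close> with \<open>M\<close> and of \<open>N \<otimes> A^0\<close> with \<open>N\<close>, and its cohomology class.
\<close>

definition cochain0 ::
  "('k::field, 'a::ring_1) bialg \<Rightarrow> ('k, 'a, 'm::ab_group_add) yd \<Rightarrow> ('k, 'a, 'n::ab_group_add) yd
     \<Rightarrow> ('m \<Rightarrow> 'n) \<Rightarrow> ('k, 'a, 'm, 'n) cochain" where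
  "cochain0 A M N f = (\<lambda>n p. if n = 0 \<and> p = 0
     then hom_of A M 0 (\<lambda>_ m. pure (ascale A) (mscale N) [] (f m) []) else 0)"

definition class0 ::
  "('k::field, 'a::ring_1) bialg \<Rightarrow> ('k, 'a, 'm::ab_group_add) yd \<Rightarrow> ('k, 'a, 'n::ab_group_add) yd
     \<Rightarrow> ('m \<Rightarrow> 'n) \<Rightarrow> ('k, 'a, 'm, 'n) cochain set" where
  "class0 A M N f = coh_class A M N 0 (cochain0 A M N f)"

end

theory Submission
  imports Defs
begin

text \<open>
  A cochain of total degree 0 is a single linear map \<open>f: M \<rightarrow> N\<close>, and there are no coboundaries
  in this degree.  Its differential has the components \<open>d\<^sub>m f = b\<^sub>0 f - b\<^sub>1 f\<close> in \<open>Y\<^sup>1\<^sup>,\<^sup>0\<close> and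
  \<open>d\<^sub>c f = c\<^sub>0 f - c\<^sub>1 f\<close> in \<open>Y\<^sup>0\<^sup>,\<^sup>1\<close>; these are \<open>a \<otimes> m \<mapsto> a \<cdot> f m - f (a \<cdot> m)\<close> and
  \<open>m \<mapsto> \<rho>\<^sub>N (f m) - (f \<otimes> id) (\<rho>\<^sub>M m)\<close>, so they vanish exactly if \<open>f\<close> is linear, respectively
  colinear, over \<open>A\<close>.
\<close>

section \<open>Maps out of tensor products\<close>

interpretation tens: vector_space "tscale :: 'k::field \<Rightarrow> ('x \<Rightarrow>\<^sub>0 'k) \<Rightarrow> ('x \<Rightarrow>\<^sub>0 'k)"
  by (rule vector_space_tscale)

lemma multilinear_0_0_iff:
  "multilinear sA sV s 0 0 g \<longleftrightarrow> Vector_Spaces.linear sV s (\<lambda>v. g [] v [])"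
  by (simp add: multilinear_def)

lemma multilinear_1_0_iff:
  "multilinear sA sV s (Suc 0) 0 g \<longleftrightarrow>
     (\<forall>a. Vector_Spaces.linear sV s (\<lambda>v. g [a] v [])) \<and>
     (\<forall>v. Vector_Spaces.linear sA s (\<lambda>a. g [a] v []))"
  by (fastforce simp: multilinear_def length_Suc_conv)

lemma multilinear_0_1_iff:
  "multilinear sA sV s 0 1 g \<longleftrightarrow>
     (\<forall>a. Vector_Spaces.linear sV s (\<lambda>v. g [] v [a])) \<and>
     (\<forall>v. Vector_Spaces.linear sA s (\<lambda>a. g [] v [a]))"
  by (fastforce simp: multilinear_def length_Suc_conv)

lemma multilinear_cong:
  assumes "\<And>xs v ys. length xs = n \<Longrightarrow> length ys = p \<Longrightarrow> g xs v ys = h xs v ys"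
  shows "multilinear sA sV s n p g \<longleftrightarrow> multilinear sA sV s n p h"
  using assms by (simp add: multilinear_def)

text \<open>By \<open>tensor_eq_span_pure\<close> the pure tensors span, so testing on them suffices
  even though elements of \<open>tensor\<close> are normal forms.\<close>

lemma linear_eq_on_tensor:
  assumes F: "Vector_Spaces.linear tscale s F" and G: "Vector_Spaces.linear tscale s G"
    and eq: "\<And>xs v ys. length xs = n \<Longrightarrow> length ys = p \<Longrightarrow>
      F (pure sA sV xs v ys) = G (pure sA sV xs v ys)"
    and t: "t \<in> tensor sA sV n p"
  shows "F t = G t"
proof -
  interpret F: Vector_Spaces.linear tscale s F by fact
  interpret VP: vector_space_pair tscale s ..
  show ?thesis
    by (rule VP.linear_eq_on[OF F G t[unfolded tensor_eq_span_pure]]) (use eq in auto)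
qed

text \<open>Multilinearity only concerns lists of the given lengths, so it passes from
  \<open>h\<close> to \<open>g\<close>, and both lifts then agree on pure tensors. Through
  \<open>hom_of_cong\<close> this replaces the bodies of the structure maps, written with
  \<open>hd\<close>, \<open>tl\<close> and \<open>last\<close>, by simplified ones.\<close>

lemma lift_cong:
  assumes s: "vector_space s" and h: "multilinear sA sV s n p h"
    and eq: "\<And>xs v ys. length xs = n \<Longrightarrow> length ys = p \<Longrightarrow> g xs v ys = h xs v ys"
    and t: "t \<in> tensor sA sV n p"
  shows "lift s g t = lift s h t"
proof (rule linear_eq_on_tensor[OF linear_lift[OF s] linear_lift[OF s] _ t])
  have g: "multilinear sA sV s n p g"
    using h multilinear_cong[of n p g h sA sV s] eq by blast
  show "lift s g (pure sA sV xs v ys) = lift s h (pure sA sV xs v ys)"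
    if "length xs = n" "length ys = p" for xs v ys
    using that by (simp add: lift_pure[OF s g] lift_pure[OF s h] eq)
qed

lemma lift_pure_id:
  assumes "vector_space sA" "vector_space sV" "t \<in> tensor sA sV n p"
  shows "lift tscale (pure sA sV) t = t"
  by (rule linear_eq_on_tensor[OF linear_lift[OF vector_space_tscale] tens.linear_ident _ assms(3)])
    (simp add: lift_pure[OF vector_space_tscale multilinear_pure[OF assms(1,2)]])

lemma lift_zero [simp]: "lift tscale g 0 = 0" "lift tscale (\<lambda>_ _ _. 0) t = 0"
  by (simp_all add: lift_def case_prod_beta)

lemma subspace_tensor: "tens.subspace (tensor sA sV n p)"
  unfolding tensor_eq_span_pure by (rule tens.subspace_span)

lemma pure_in_tensor:
  "length xs = n \<Longrightarrow> length ys = p \<Longrightarrow> pure sA sV xs v ys \<in> tensor sA sV n p"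
  unfolding tensor_eq_span_pure by (rule tens.span_base) blast

lemma lift_in_subspace:
  assumes "tens.subspace S" "\<And>xs v ys. g xs v ys \<in> S"
  shows "lift tscale g t \<in> S"
  unfolding lift_def
  by (intro tens.subspace_sum[OF assms(1)] tens.subspace_scale[OF assms(1)])
    (simp add: assms(2) case_prod_beta)

lemma linear_pure_0_0:
  assumes "vector_space sA" "vector_space sV"
  shows "Vector_Spaces.linear sV tscale (\<lambda>v. pure sA sV [] v [])"
  using multilinear_pure[OF assms, of 0 0] by (simp add: multilinear_0_0_iff)

lemma linear_sw: "vector_space s \<Longrightarrow> Vector_Spaces.linear tscale s (sw s g)"
  unfolding sw_def by (rule linear_lift)

section \<open>The double complex in total degrees 0 and 1\<close>

lemma hom_of_pure:
  assumes "multilinear (ascale A) (mscale M) tscale n 0 (\<lambda>as m _. g as m)" "length as = n"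
  shows "hom_of A M n g (pure (ascale A) (mscale M) as m []) = g as m"
  using assms
  by (simp add: hom_of_def pure_in_tensor lift_pure[OF vector_space_tscale, where p = 0])

lemma hom_of_cong:
  assumes "multilinear (ascale A) (mscale M) tscale n 0 (\<lambda>as m _. h as m)"
    and "\<And>as m. length as = n \<Longrightarrow> g as m = h as m"
  shows "hom_of A M n g = hom_of A M n h"
  using lift_cong[OF vector_space_tscale assms(1), of "\<lambda>as m _. g as m"] assms(2)
  by (auto simp: hom_of_def fun_eq_iff)

text \<open>Evaluation on pure tensors recovers both multilinear maps, so identities between
  cochains turn into pointwise identities in \<open>as\<close> and \<open>m\<close>.\<close>

lemma hom_of_eq_iff:
  assumes g: "multilinear (ascale A) (mscale M) tscale n 0 (\<lambda>as m _. g as m)"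
    and h: "multilinear (ascale A) (mscale M) tscale n 0 (\<lambda>as m _. h as m)"
  shows "hom_of A M n g = hom_of A M n h \<longleftrightarrow> (\<forall>as m. length as = n \<longrightarrow> g as m = h as m)"
proof
  assume eq: "hom_of A M n g = hom_of A M n h"
  show "\<forall>as m. length as = n \<longrightarrow> g as m = h as m"
    using hom_of_pure[OF g] hom_of_pure[OF h] by (metis eq)
qed (use hom_of_cong[OF h] in blast)

lemma hom_of_zero: "hom_of A M n (\<lambda>_ _. 0) = 0"
  by (simp add: hom_of_def fun_eq_iff)

text \<open>\<open>lift\<close> is linear on formal combinations for any \<open>g\<close>, and its
  values are finite linear combinations of values of \<open>g\<close>, hence stay in the target
  subspace.\<close>

lemma hom_of_in_Y_space:
  assumes "\<And>as m. g as m \<in> tensor (ascale A) (mscale N) 0 p"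
  shows "hom_of A M n g \<in> Y_space A M N n p"
proof -
  interpret L: Vector_Spaces.linear tscale tscale "lift tscale (\<lambda>as m _. g as m)"
    by (rule linear_lift[OF vector_space_tscale])
  note S = subspace_tensor[of "ascale A" "mscale M" n 0]
  have "lift tscale (\<lambda>as m _. g as m) t \<in> tensor (ascale A) (mscale N) 0 p" for t
    by (rule lift_in_subspace[OF subspace_tensor assms])
  moreover have "tscale c t \<in> tensor (ascale A) (mscale M) n 0"
    if "t \<in> tensor (ascale A) (mscale M) n 0" for c t
    using tens.subspace_scale[OF S that] .
  moreover have "t + t' \<in> tensor (ascale A) (mscale M) n 0"
    if "t \<in> tensor (ascale A) (mscale M) n 0" "t' \<in> tensor (ascale A) (mscale M) n 0" for t t'
    using tens.subspace_add[OF S that] .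
  ultimately show ?thesis
    by (simp add: Y_space_def hom_space_def hom_of_def L.add L.scale)
qed

lemma sw_zero [simp]: "sw tscale (\<lambda>_ _. 0) t = 0"
  by (simp add: sw_def)

lemma sw_iter_zero [simp]: "sw_iter A r (\<lambda>_. 0) a = 0"
  by (simp add: sw_iter_def)

lemma sw_list_zero [simp]: "sw_list A (\<lambda>_ _. 0) as = 0"
  by (induction as) simp_all

text \<open>Used, like \<open>c_map_zero\<close>, for the components of a cochain outside its total
  degree, which are the zero function.\<close>

lemma b_map_zero: "b_map A M N n p i 0 = 0"
  by (simp add: b_map_def hom_of_zero cong: if_cong)

lemma c_map_zero: "c_map A M N n p i 0 = 0"
  by (simp add: c_map_def hom_of_zero cong: if_cong)

lemma d_m_zero: "d_m A M N n p 0 = 0"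
  by (simp add: d_m_def b_map_zero fun_eq_iff)

lemma d_c_zero: "d_c A M N n p 0 = 0"
  by (simp add: d_c_def c_map_zero fun_eq_iff)

lemma d_m_0_0: "d_m A M N 0 0 F = 0 \<longleftrightarrow> b_map A M N 0 0 0 F = b_map A M N 0 0 1 F"
  by (simp add: d_m_def fun_eq_iff)

lemma d_c_0_0: "d_c A M N 0 0 F = 0 \<longleftrightarrow> c_map A M N 0 0 0 F = c_map A M N 0 0 1 F"
  by (simp add: d_c_def fun_eq_iff)

text \<open>Only \<phi> 0 0 can be nonzero; \<open>d_m\<close> raises the first index and
  \<open>d_c\<close> the second, so the differential lives at (1, 0) and (0, 1). The sign in front
  of \<open>d_c\<close> is (-1)^0 = 1.\<close>

lemma total_d_degree_0:
  assumes "\<phi> \<in> total_cochains A M N 0"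
  shows "total_d A M N \<phi> = 0 \<longleftrightarrow> d_m A M N 0 0 (\<phi> 0 0) = 0 \<and> d_c A M N 0 0 (\<phi> 0 0) = 0"
proof -
  have z: "\<phi> n p = 0" if "n \<noteq> 0 \<or> p \<noteq> 0" for n p
    using assms that by (auto simp: total_cochains_def split: if_splits)
  have "total_d A M N \<phi> n p = 0" if "(n, p) \<noteq> (1, 0)" "(n, p) \<noteq> (0, 1)" for n p
    using that by (cases n; cases p) (auto simp: total_d_def z d_m_zero d_c_zero fun_eq_iff)
  moreover have "total_d A M N \<phi> 1 0 = d_m A M N 0 0 (\<phi> 0 0)"
    and "total_d A M N \<phi> 0 1 = d_c A M N 0 0 (\<phi> 0 0)"
    by (simp_all add: total_d_def fun_eq_iff)
  moreover have "total_d A M N \<phi> = 0 \<longleftrightarrow> (\<forall>n p. total_d A M N \<phi> n p = 0)"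
    by (simp add: fun_eq_iff)
  ultimately show ?thesis by (metis prod.inject zero_neq_one)
qed

section \<open>Degree zero cohomology\<close>

locale yd_pair = M: yetter_drinfeld A M + N: yetter_drinfeld A N
  for A :: "('k::field, 'a::ring_1) bialg"
    and M :: "('k, 'a, 'm::ab_group_add) yd"
    and N :: "('k, 'a, 'n::ab_group_add) yd"
begin

text \<open>The canonical isomorphism from \<open>N \<otimes> A^0\<close> to \<open>N\<close>.\<close>

definition proj :: "('k, 'a, 'n) tens \<Rightarrow> 'n" where
  "proj = lift (mscale N) (\<lambda>_ v _. v)"

text \<open>The component of \<open>cochain0 A M N f\<close> at (0, 0), all others being
  zero.\<close>

definition F0 :: "('m \<Rightarrow> 'n) \<Rightarrow> ('k, 'a, 'm) tens \<Rightarrow> ('k, 'a, 'n) tens" where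
  "F0 f = hom_of A M 0 (\<lambda>_ m. pure (ascale A) (mscale N) [] (f m) [])"

abbreviation pureN :: "'n \<Rightarrow> 'a list \<Rightarrow> ('k, 'a, 'n) tens" where
  "pureN v ys \<equiv> pure (ascale A) (mscale N) [] v ys"

abbreviation pureM :: "'a list \<Rightarrow> 'm \<Rightarrow> ('k, 'a, 'm) tens" where
  "pureM as m \<equiv> pure (ascale A) (mscale M) as m []"

lemma linear_pureN: "Vector_Spaces.linear (mscale N) tscale (\<lambda>v. pureN v [])"
  by (rule linear_pure_0_0[OF M.vector_space_A N.vector_space_M])

lemma linear_proj: "Vector_Spaces.linear tscale (mscale N) proj"
  unfolding proj_def by (rule linear_lift[OF N.vector_space_M])

lemma proj_pureN [simp]: "proj (pureN v []) = v"
  unfolding proj_def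
  by (rule lift_pure[where n = 0 and p = 0])
    (simp_all add: N.vector_space_M multilinear_0_0_iff vector_space.linear_ident)

lemma pureN_inject: "pureN v [] = pureN w [] \<longleftrightarrow> v = w"
  by (metis proj_pureN)

lemma pureN_proj:
  assumes "t \<in> tensor (ascale A) (mscale N) 0 0"
  shows "pureN (proj t) [] = t"
  by (rule linear_eq_on_tensor[OF Vector_Spaces.linear_compose[OF linear_proj linear_pureN, unfolded o_def]
        tens.linear_ident _ assms]) simp

text \<open>On lists of length one \<open>[hd ys]\<close> is \<open>ys\<close>, so the left side is
  the lift of \<open>pure\<close>, which fixes every tensor.\<close>

lemma sw_coact_pureN: "sw tscale (\<lambda>v0 v1. pureN v0 [v1]) (coact N v) = coact N v"
proof -
  have "sw tscale (\<lambda>v0 v1. pureN v0 [v1]) (coact N v) =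
      lift tscale (pure (ascale A) (mscale N)) (coact N v)"
    unfolding sw_def
    by (rule lift_cong[OF vector_space_tscale multilinear_pure[OF M.vector_space_A N.vector_space_M]
          _ N.coact_in]) (auto simp: length_Suc_conv)
  also have "\<dots> = coact N v"
    by (rule lift_pure_id[OF M.vector_space_A N.vector_space_M N.coact_in])
  finally show ?thesis .
qed

text \<open>For r = 0 no comultiplication takes place: \<open>iter_comul A 0 a\<close> is the pure
  tensor of \<open>a\<close> in A \<otimes> A^0.\<close>

lemma sw_iter_0:
  assumes "Vector_Spaces.linear (ascale A) tscale (\<lambda>b. g [b])"
  shows "sw_iter A 0 g a = g [a]"
  unfolding sw_iter_def iter_comul.simps
  by (rule lift_pure[OF vector_space_tscale, where n = 0 and p = 0])
    (simp_all add: multilinear_0_0_iff assms)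

context
  fixes f :: "'m \<Rightarrow> 'n"
  assumes f: "Vector_Spaces.linear (mscale M) (mscale N) f"
begin

lemma multilinear_F0:
  "multilinear (ascale A) (mscale M) tscale 0 0 (\<lambda>_ m _. pureN (f m) [])"
  using Vector_Spaces.linear_compose[OF f linear_pureN] by (simp add: multilinear_0_0_iff o_def)

lemma F0_pure [simp]: "F0 f (pureM [] m) = pureN (f m) []"
  unfolding F0_def by (simp add: hom_of_pure[OF multilinear_F0])

section \<open>The differential \<open>d_m\<close> of a linear map, and A-linearity\<close>

lemma multilinear_act_f:
  "multilinear (ascale A) (mscale M) tscale (Suc 0) 0 (\<lambda>as m _. pureN (act N (hd as) (f m)) [])"
  using Vector_Spaces.linear_compose[OF Vector_Spaces.linear_compose[OF f N.act_linear_right] linear_pureN]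
    Vector_Spaces.linear_compose[OF N.act_linear_left linear_pureN]
  by (simp add: multilinear_1_0_iff o_def)

lemma multilinear_f_act:
  "multilinear (ascale A) (mscale M) tscale (Suc 0) 0 (\<lambda>as m _. pureN (f (act M (hd as) m)) [])"
  using Vector_Spaces.linear_compose[OF Vector_Spaces.linear_compose[OF M.act_linear_right f] linear_pureN]
    Vector_Spaces.linear_compose[OF Vector_Spaces.linear_compose[OF M.act_linear_left f] linear_pureN]
  by (simp add: multilinear_1_0_iff o_def)

lemma lift_act:
  "lift tscale (\<lambda>_ v ys. pureN (act N a v) []) (pureN v []) = pureN (act N a v) []"
  using Vector_Spaces.linear_compose[OF N.act_linear_right linear_pureN]
  by (intro lift_pure[OF vector_space_tscale, where n = 0 and p = 0])
    (simp_all add: multilinear_0_0_iff o_def)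

lemma lift_pureN: "lift tscale (\<lambda>_ v ys. pureN v []) (pureN v []) = pureN v []"
  by (rule lift_pure[OF vector_space_tscale, where n = 0 and p = 0])
    (simp_all add: multilinear_0_0_iff linear_pureN)

text \<open>For p = 0 the list \<open>us\<close> is just [a], so \<open>map2\<close> yields the
  empty list and only the action on f m remains.\<close>

lemma b_map_0_F0:
  "b_map A M N 0 0 0 (F0 f) = hom_of A M (Suc 0) (\<lambda>as m. pureN (act N (hd as) (f m)) [])"
proof -
  have "sw_iter A 0 (\<lambda>us. lift tscale
      (\<lambda>_ v ys. pureN (act N (hd us) v) (map2 (*) (tl us) ys)) (pureN (f m) [])) a =
    pureN (act N a (f m)) []" for a m
    using Vector_Spaces.linear_compose[OF N.act_linear_left linear_pureN]
    by (subst sw_iter_0) (simp_all add: lift_act o_def)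
  then show ?thesis
    unfolding b_map_def by (simp, intro hom_of_cong multilinear_act_f) (auto simp: length_Suc_conv)
qed

text \<open>For n = 0 the index 1 is n + 1, so the last branch of \<open>b_map\<close> applies;
  \<open>butlast us\<close> is empty and \<open>last us\<close> is a.\<close>

lemma b_map_1_F0:
  "b_map A M N 0 0 1 (F0 f) = hom_of A M (Suc 0) (\<lambda>as m. pureN (f (act M (hd as) m)) [])"
proof -
  have "sw_iter A 0 (\<lambda>us. lift tscale
      (\<lambda>_ v ys. pureN v (map2 (*) ys (butlast us))) (F0 f (pureM [] (act M (last us) m)))) a =
    pureN (f (act M a m)) []" for a m
    using Vector_Spaces.linear_compose[OF Vector_Spaces.linear_compose[OF M.act_linear_left f] linear_pureN]
    by (subst sw_iter_0) (simp_all add: lift_pureN o_def)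
  then show ?thesis
    unfolding b_map_def by (simp, intro hom_of_cong multilinear_f_act) (auto simp: length_Suc_conv)
qed

lemma d_m_F0: "d_m A M N 0 0 (F0 f) = 0 \<longleftrightarrow> (\<forall>a m. f (act M a m) = act N a (f m))"
proof -
  have "d_m A M N 0 0 (F0 f) = 0 \<longleftrightarrow> (\<forall>as m. length as = Suc 0 \<longrightarrow>
      act N (hd as) (f m) = f (act M (hd as) m))"
    unfolding d_m_0_0 b_map_0_F0 b_map_1_F0
      hom_of_eq_iff[OF multilinear_act_f multilinear_f_act] pureN_inject ..
  also have "\<dots> \<longleftrightarrow> (\<forall>a m. f (act M a m) = act N a (f m))"
    by (metis length_Cons list.size(3) list.sel(1))
  finally show ?thesis .
qed

section \<open>The differential \<open>d_c\<close> of a linear map, and A-colinearity\<close>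

lemma multilinear_coact_f:
  "multilinear (ascale A) (mscale M) tscale 0 0 (\<lambda>_ m _. coact N (f m))"
  using Vector_Spaces.linear_compose[OF f N.coact_linear] by (simp add: multilinear_0_0_iff o_def)

lemma multilinear_f_coact:
  "multilinear (ascale A) (mscale M) tscale 0 0
     (\<lambda>_ m _. sw tscale (\<lambda>m0 m1. pureN (f m0) [m1]) (coact M m))"
  using Vector_Spaces.linear_compose[OF M.coact_linear linear_sw[OF vector_space_tscale]]
  by (simp add: multilinear_0_0_iff o_def)

text \<open>For n = p = 0 the factor \<open>prod_list us\<close> is the empty product 1 and
  \<open>ys\<close> is empty, so \<open>sw_coact_pureN\<close> reassembles the coaction of f
  m.\<close>

lemma c_map_0_F0: "c_map A M N 0 0 0 (F0 f) = hom_of A M 0 (\<lambda>_ m. coact N (f m))"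
proof -
  have "lift tscale (\<lambda>_ v ys. sw tscale (\<lambda>v0 v1. pureN v0 ((v1 * 1) # ys)) (coact N v))
      (pureN w []) = coact N w" for w
    using N.coact_linear
    by (subst lift_pure[OF vector_space_tscale, where n = 0 and p = 0])
      (simp_all add: multilinear_0_0_iff sw_coact_pureN)
  then show ?thesis
    unfolding c_map_def by (simp, intro hom_of_cong multilinear_coact_f) simp
qed

text \<open>For p = 0 the index 1 is p + 1, so the last branch of \<open>c_map\<close> applies; its
  factor \<open>prod_list vs\<close> is the empty product 1.\<close>

lemma c_map_1_F0:
  "c_map A M N 0 0 1 (F0 f) =
     hom_of A M 0 (\<lambda>_ m. sw tscale (\<lambda>m0 m1. pureN (f m0) [m1]) (coact M m))"
proof -
  have "lift tscale (\<lambda>_ v ys. pureN v (ys @ [1 * m1])) (pureN w []) = pureN w [m1]" for w m1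
    using multilinear_pure[OF M.vector_space_A N.vector_space_M, of 0 1]
    unfolding multilinear_0_1_iff
    by (subst lift_pure[OF vector_space_tscale, where n = 0 and p = 0])
      (simp_all add: multilinear_0_0_iff)
  then show ?thesis
    unfolding c_map_def by (simp, intro hom_of_cong multilinear_f_coact) simp
qed

lemma d_c_F0:
  "d_c A M N 0 0 (F0 f) = 0 \<longleftrightarrow>
     (\<forall>m. coact N (f m) = sw tscale (\<lambda>m0 m1. pureN (f m0) [m1]) (coact M m))"
proof -
  have "d_c A M N 0 0 (F0 f) = 0 \<longleftrightarrow> (\<forall>as :: 'a list. \<forall>m. length as = 0 \<longrightarrow>
      coact N (f m) = sw tscale (\<lambda>m0 m1. pureN (f m0) [m1]) (coact M m))"
    unfolding d_c_0_0 c_map_0_F0 c_map_1_F0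
    by (rule hom_of_eq_iff[OF multilinear_coact_f multilinear_f_coact])
  also have "\<dots> \<longleftrightarrow> (\<forall>m. coact N (f m) = sw tscale (\<lambda>m0 m1. pureN (f m0) [m1]) (coact M m))"
    by auto
  finally show ?thesis .
qed

section \<open>Cochains of degree 0 as linear maps from M to N\<close>

lemma cochain0_in_total_cochains: "cochain0 A M N f \<in> total_cochains A M N 0"
  by (simp add: total_cochains_def cochain0_def hom_of_in_Y_space pure_in_tensor)

lemma cochain0_in_cocycles_iff: "cochain0 A M N f \<in> cocycles A M N 0 \<longleftrightarrow> f \<in> yd_homs A M N"
proof -
  have "cochain0 A M N f 0 0 = F0 f" by (simp add: cochain0_def F0_def)
  then show ?thesis
    using cochain0_in_total_cochains f
    by (simp add: cocycles_def yd_homs_def total_d_degree_0 d_m_F0 d_c_F0)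
qed

end

lemma cochain0_inject:
  assumes f: "Vector_Spaces.linear (mscale M) (mscale N) f"
    and g: "Vector_Spaces.linear (mscale M) (mscale N) g"
    and eq: "cochain0 A M N f = cochain0 A M N g"
  shows "f = g"
proof
  fix m
  have "F0 f = F0 g"
    using fun_cong[OF fun_cong[OF eq, of 0], of 0] by (simp add: cochain0_def F0_def)
  then have "F0 f (pureM [] m) = F0 g (pureM [] m)" by simp
  then show "f m = g m" by (simp add: f g pureN_inject)
qed

text \<open>The witness f embeds M into A^0 \<otimes> M, applies the component at (0, 0), and
  returns to N by \<open>proj\<close>.\<close>

lemma cochain0_surj:
  assumes \<phi>: "\<phi> \<in> total_cochains A M N 0"
  obtains f where "Vector_Spaces.linear (mscale M) (mscale N) f" "\<phi> = cochain0 A M N f"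
proof
  define F where "F = \<phi> 0 0"
  define f where "f = (\<lambda>m. proj (F (pureM [] m)))"
  let ?T = "tensor (ascale A) (mscale M) 0 0"
  have z: "\<phi> n p = 0" if "n \<noteq> 0 \<or> p \<noteq> 0" for n p
    using \<phi> that by (auto simp: total_cochains_def split: if_splits)
  have "F \<in> Y_space A M N 0 0"
    using \<phi> by (auto simp: total_cochains_def F_def split: if_splits)
  then have F_in: "\<And>t. t \<in> ?T \<Longrightarrow> F t \<in> tensor (ascale A) (mscale N) 0 0"
    and F_add: "\<And>t u. t \<in> ?T \<Longrightarrow> u \<in> ?T \<Longrightarrow> F (t + u) = F t + F u"
    and F_scale: "\<And>c t. t \<in> ?T \<Longrightarrow> F (tscale c t) = tscale c (F t)"
    and F_out: "\<And>t. t \<notin> ?T \<Longrightarrow> F t = 0"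
    by (auto simp: Y_space_def hom_space_def)
  interpret P: Vector_Spaces.linear "mscale M" tscale "\<lambda>m. pureM [] m"
    by (rule linear_pure_0_0[OF M.vector_space_A M.vector_space_M])
  interpret J: Vector_Spaces.linear tscale "mscale N" proj by (rule linear_proj)
  show f: "Vector_Spaces.linear (mscale M) (mscale N) f"
    unfolding Vector_Spaces.linear_iff f_def
    by (simp add: M.vector_space_M N.vector_space_M P.add P.scale J.add J.scale F_add F_scale
        pure_in_tensor)
  have eq: "F t = F0 f t" if t: "t \<in> ?T" for t
  proof -
    interpret L: Vector_Spaces.linear tscale tscale "lift tscale (\<lambda>_ m _. pureN (f m) [])"
      by (rule linear_lift[OF vector_space_tscale])
    have *: "F0 f u = lift tscale (\<lambda>_ m _. pureN (f m) []) u" if "u \<in> ?T" for u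
      using that by (simp add: F0_def hom_of_def)
    have "t \<in> tens.span {pureM [] m | m. True}"
      using t by (simp add: tensor_eq_span_pure)
    \<comment> \<open>\<open>F\<close> is known to be linear only on \<open>?T\<close>, so
      \<open>linear_eq_on_tensor\<close> does not apply. The induction over the span carries
      membership in \<open>?T\<close> along, which \<open>F_add\<close> and \<open>F_scale\<close>
      require.\<close>
    then have "t \<in> ?T \<and> F t = F0 f t"
    proof (induction rule: tens.span_induct_alt)
      case base
      have "F 0 = 0" using F_scale[OF tens.subspace_0[OF subspace_tensor], of 0] by simp
      then show ?case using tens.subspace_0[OF subspace_tensor] by (auto simp: *)
    next
      case (step c x y)
      then obtain m where m: "x = pureM [] m" by blast
      then have x: "x \<in> ?T" by (simp add: pure_in_tensor)
      moreover have "F x = pureN (f m) []"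
        using pureN_proj[OF F_in[OF x]] by (simp add: m f_def)
      then have "F x = F0 f x" by (simp add: m F0_pure[OF f])
      moreover have "tscale c x \<in> ?T" by (rule tens.subspace_scale[OF subspace_tensor x])
      ultimately show ?case
        using step tens.subspace_add[OF subspace_tensor, of "tscale c x" _ _ _ _ y]
        by (simp add: F_add F_scale * L.add L.scale)
    qed
    then show ?thesis ..
  qed
  \<comment> \<open>Off \<open>?T\<close> both sides vanish by the extension-by-zero convention, so
    they agree as functions.\<close>
  have "F = F0 f"
    using eq F_out by (auto simp: F0_def hom_of_def fun_eq_iff)
  then show "\<phi> = cochain0 A M N f"
    using z by (auto simp: cochain0_def F0_def F_def fun_eq_iff)
qed

section \<open>Cohomology in degree 0 and its vector space structure\<close>

lemma coh_class_0 [simp]: "coh_class A M N 0 \<phi> = {\<phi>}"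
  by (simp add: coh_class_def coboundaries_def)

text \<open>Classes in degree 0 are singletons, so it suffices that \<open>cochain0\<close> is
  injective on linear maps and maps \<open>yd_homs\<close> onto the cocycles.\<close>

lemma bij_class0: "bij_betw (class0 A M N) (yd_homs A M N) (cohomology A M N 0)"
  unfolding bij_betw_def
proof
  show "inj_on (class0 A M N) (yd_homs A M N)"
    by (rule inj_onI) (auto simp: class0_def yd_homs_def intro: cochain0_inject)
  have "cochain0 A M N ` yd_homs A M N = cocycles A M N 0"
  proof (intro equalityI subsetI)
    fix \<phi> assume "\<phi> \<in> cochain0 A M N ` yd_homs A M N"
    then show "\<phi> \<in> cocycles A M N 0"
      using cochain0_in_cocycles_iff by (auto simp: yd_homs_def)
  next
    fix \<phi> assume \<phi>: "\<phi> \<in> cocycles A M N 0"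
    then have "\<phi> \<in> total_cochains A M N 0" by (simp add: cocycles_def)
    then obtain f where "Vector_Spaces.linear (mscale M) (mscale N) f" "\<phi> = cochain0 A M N f"
      by (rule cochain0_surj)
    with \<phi> show "\<phi> \<in> cochain0 A M N ` yd_homs A M N"
      using cochain0_in_cocycles_iff by blast
  qed
  then show "class0 A M N ` yd_homs A M N = cohomology A M N 0"
    by (auto simp: class0_def cohomology_def image_iff)
qed

text \<open>At each t in the tensor space, all the lifts sum over the keys of t with the same
  coefficients, so additivity of \<open>pureN\<close> in its vector argument gives the claim term by
  term.\<close>

lemma cochain0_add: "cochain0 A M N (\<lambda>m. f m + g m) = cochain0 A M N f + cochain0 A M N g"
proof -
  interpret P: Vector_Spaces.linear "mscale N" tscale "\<lambda>v. pureN v []" by (rule linear_pureN)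
  show ?thesis
    by (simp add: fun_eq_iff cochain0_def hom_of_def lift_def P.add case_prod_beta
        tens.scale_right_distrib sum.distrib)
qed

lemma cochain0_scale:
  "cochain0 A M N (\<lambda>m. mscale N c (f m)) = cochain_scale c (cochain0 A M N f)"
proof -
  interpret P: Vector_Spaces.linear "mscale N" tscale "\<lambda>v. pureN v []" by (rule linear_pureN)
  show ?thesis
    by (simp add: fun_eq_iff cochain0_def cochain_scale_def hom_of_def lift_def P.scale
        case_prod_beta tens.scale_sum_right mult.commute)
qed

lemma class0_add: "class0 A M N (\<lambda>m. f m + g m) = coh_add (class0 A M N f) (class0 A M N g)"
  by (simp add: class0_def coh_add_def cochain0_add)

lemma class0_scale:
  "class0 A M N (\<lambda>m. mscale N c (f m)) = coh_scale A M N 0 c (class0 A M N f)"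
  by (simp add: class0_def coh_scale_def coboundaries_def cochain0_scale)

end

theorem mainTheorem2:
  fixes A :: "('k::field, 'a::ring_1) bialg"
    and M :: "('k, 'a, 'm::ab_group_add) yd"
    and N :: "('k, 'a, 'n::ab_group_add) yd"
  assumes "bialgebra A"
    and "yetter_drinfeld A M"
    and "yetter_drinfeld A N"
  shows "bij_betw (class0 A M N) (yd_homs A M N) (cohomology A M N 0) \<and>
    (\<forall>f\<in>yd_homs A M N. \<forall>g\<in>yd_homs A M N.
       class0 A M N (\<lambda>m. f m + g m) = coh_add (class0 A M N f) (class0 A M N g)) \<and>
    (\<forall>c. \<forall>f\<in>yd_homs A M N.
       class0 A M N (\<lambda>m. mscale N c (f m)) = coh_scale A M N 0 c (class0 A M N f))"
proof -
  interpret yd_pair A M N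
    using assms(2,3) by (rule yd_pair.intro)
  show ?thesis
    using bij_class0 class0_add class0_scale by blast
qed

end
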